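(* Let $S$ be a proper Ehresmann semigroup and let $Y$ be a proper generating ideal of $S$. Then $S\simeq P(S)\rtimes_{\mathcal G_{S,Y}} S/\sigma$ (as Ehresmann semigroups, i.e. as $(2,1,1)$-algebras), where $\mathcal G_{S,Y}$ is the underlying graph of $S$ with respect to $Y$.
   Context: **Ehresmann semigroups.** An Ehresmann semigroup is an algebra $(S;\cdot\,,{}^+,{}^* )$ with $(S;\cdot)$ a semigroup and unary operations ${}^+,{}^*$ satisfying $x^+x=x$, $(x^+y^+)^+=x^+y^+=y^+x^+$, $(xy)^+=(xy^+)^+$, $xx^*=x$, $(x^*y^* )^*=x^*y^*=y^*x^*$, $(xy)^*=(x^*y)^*$, $(x^+)^*=x^+$, $(x^* )^+=x^*$. $P(S)=\{s^+\colon s\in S\}=\{s^*\colon s\in S\}$ is the semilattice of projections, with $e\le f$ iff $e=ef$. The natural partial order: $a\leq b$ iff $a=ebf$ for some $e,f\in P(S)$. $\sigma$ is the minimum congruence on $S$ identifying all elements of $P(S)$; $[a]_\sigma$ is the $\sigma$-class of $a$; $S/\sigma$ is a monoid whose identity $1$ is the common class of the projections. **Proper Ehresmann semigroups.** A matching factorization of $s\in S$ is a tuple $(s_1,\dots,s_n)$ of elements of $S$, $n\ge1$, with $s=s_1\cdots s_n$ and $s_i^*=s_{i+1}^+$ for $1\le i\le n-1$. An element $s$ is proper if for all $t\in S$: $t^+=s^+$, $t^*=s^*$ and $t\mathrel{\sigma}s$ imply $t=s$. A matching factorization $(s_1,\dots,s_n)$ is into a product of proper elements (respectively of elements of a subset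 $Y\subseteq S$) if all $s_i$ are proper (respectively belong to $Y$). If $(s_1,\dots,s_n)$ is a matching factorization of $s$ into a product of proper elements and $i\le j$ are such that $t=s_i\cdots s_j$ is a proper element of $S$, then $(s_1,\dots,s_{i-1},t,s_{j+1},\dots,s_n)$ is also a matching factorization of $s$ into a product of proper elements, and one writes $(s_1,\dots,s_n)\to(s_1,\dots,s_{i-1},t,s_{j+1},\dots,s_n)$. Two matching factorizations of $s$ into products of proper elements are equivalent if one can be obtained from the other by finitely many applications of the relation $\to$ or its inverse. $S$ is proper if it has an order ideal $Y$ with respect to $\leq$ (called a proper generating ideal) such that $P(S)\subseteq Y$, all elements of $Y$ are proper, and each $s\in S$ admits a unique, up to equivalence, matching factorization as a product of elements of $Y$. **The graph $\mathcal G_{S,Y}$.** Its vertices are the elements of $P(S)$ and its edges are the triples $(a^+,[a]_\sigma,a^* )$, $a\in Y$ (an edge from $a^+$ to $a^*$ with label $[a]_\sigma\in S/\sigma$); $a\mapsto(a^+,[a]_\sigma,a^* )$ is a bijection from $Y$ onto the edge set $\mathrm E(\mathcal G_{S,Y})$. For $p=(a^+,[a]_\sigma,a^* )$, $a\in Y$, and projections $g\le a^+$, $h\le a^*$ put ${}_g|p=((ga)^+,[ga]_\sigma,(ga)^* )=(g,[a]_\sigma,(ga)^* )$ (restriction) and $p|_h=((ah)^+,[ah]_\sigma,(ah)^* )=((ah)^+,[a]_\sigma,h)$ (corestriction). **The algebra $E\rtimes_{\mathcal G}T$**, for $E=P(S)$, $T=S/\sigma$, $\mathcal G=\mathcal G_{S,Y}$.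 For an edge $c=(e,t,f)$ put $\mathbf d(c)=e$, $\mathbf r(c)=f$. $\mathcal C(\mathcal G)$ is the semicategory of non-empty directed paths in $\mathcal G$ (objects: elements of $E$; composition: concatenation). For a path $p=p_1\cdots p_n$ with edges $p_i=(e_{i-1},t_i,e_i)$ put $\mathbf d(p)=e_0$, $\mathbf r(p)=e_n$. For $e_0'\le e_0$, ${}_{e_0'}|p$ is the path $({}_{e_0'}|p_1)({}_{e_1'}|p_2)\cdots({}_{e_{n-1}'}|p_n)$ with $e_i'=\mathbf r({}_{e_{i-1}'}|p_i)$; for $e_n'\le e_n$, $p|_{e_n'}$ is the path $(p_1|_{e_1'})\cdots(p_n|_{e_n'})$ with $e_{i-1}'=\mathbf d(p_i|_{e_i'})$. Let $\sim$ be the congruence on $\mathcal C(\mathcal G)$ generated by all pairs $(p_1\cdots p_n,\,(e_0,t_1\cdots t_n,e_n))$ with $n\ge2$, $p_i=(e_{i-1},t_i,e_i)\in\mathrm E(\mathcal G)$ and $(e_0,t_1\cdots t_n,e_n)\in\mathrm E(\mathcal G)$; let $\widetilde{\mathcal C}(\mathcal G)=\mathcal C(\mathcal G)/{\sim}$ and $[p]$ the $\sim$-class of $p$. The maps $\mathbf d,\mathbf r$, restriction and corestriction are well defined on classes: ${}_e|[p]=[{}_e|p]$, $[p]|_f=[p|_f]$. $E\rtimes_{\mathcal G}T$ is the set of arrows of $\widetilde{\mathcal C}(\mathcal G)$ with operations $c\cdot d=\big(c|_{\mathbf r(c)\mathbf d(d)}\big)\big({}_{\mathbf r(c)\mathbf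 d(d)}|d\big)$ (composition in $\widetilde{\mathcal C}(\mathcal G)$), $c^+=[(\mathbf d(c),1,\mathbf d(c))]$, $c^*=[(\mathbf r(c),1,\mathbf r(c))]$; it is an Ehresmann semigroup.
   Formalization: Equivalence of factorizations into elements of Y is taken through factorizations into elements of Y only, not arbitrary proper elements; otherwise the claim fails for the free commutative monoid on a, b with x⁺=x*=1 and Y={1,a,b}, where the construction gives the free monoid. *)

theory Defs
  imports "HOL-Algebra.Group"
begin

section \<open>Ehresmann semigroups\<close>

record 'a semigrp = "'a partial_object" +
  mul :: "'a \<Rightarrow> 'a \<Rightarrow> 'a"  (infixl \<open>\<cdot>\<index>\<close> 70)

record 'a ehr = "'a semigrp" +
  eplus :: "'a \<Rightarrow> 'a"
  estar :: "'a \<Rightarrow> 'a"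

locale ehresmann_semigroup =
  fixes S :: "'a ehr" (structure)
  assumes mul_closed: "\<lbrakk>x \<in> carrier S; y \<in> carrier S\<rbrakk> \<Longrightarrow> x \<cdot> y \<in> carrier S"
    and plus_closed: "x \<in> carrier S \<Longrightarrow> eplus S x \<in> carrier S"
    and star_closed: "x \<in> carrier S \<Longrightarrow> estar S x \<in> carrier S"
    and mul_assoc: "\<lbrakk>x \<in> carrier S; y \<in> carrier S; z \<in> carrier S\<rbrakk>
          \<Longrightarrow> (x \<cdot> y) \<cdot> z = x \<cdot> (y \<cdot> z)"
    and plus_left: "x \<in> carrier S \<Longrightarrow> eplus S x \<cdot> x = x"
    and plus_mul_plus: "\<lbrakk>x \<in> carrier S; y \<in> carrier S\<rbrakk>
          \<Longrightarrow> eplus S (eplus S x \<cdot> eplus S y) = eplus S x \<cdot> eplus S y"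
    and plus_commute: "\<lbrakk>x \<in> carrier S; y \<in> carrier S\<rbrakk>
          \<Longrightarrow> eplus S x \<cdot> eplus S y = eplus S y \<cdot> eplus S x"
    and plus_mul: "\<lbrakk>x \<in> carrier S; y \<in> carrier S\<rbrakk> \<Longrightarrow> eplus S (x \<cdot> y) = eplus S (x \<cdot> eplus S y)"
    and star_right: "x \<in> carrier S \<Longrightarrow> x \<cdot> estar S x = x"
    and star_mul_star: "\<lbrakk>x \<in> carrier S; y \<in> carrier S\<rbrakk>
          \<Longrightarrow> estar S (estar S x \<cdot> estar S y) = estar S x \<cdot> estar S y"
    and star_commute: "\<lbrakk>x \<in> carrier S; y \<in> carrier S\<rbrakk>
          \<Longrightarrow> estar S x \<cdot> estar S y = estar S y \<cdot> estar S x"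
    and star_mul: "\<lbrakk>x \<in> carrier S; y \<in> carrier S\<rbrakk> \<Longrightarrow> estar S (x \<cdot> y) = estar S (estar S x \<cdot> y)"
    and star_plus: "x \<in> carrier S \<Longrightarrow> estar S (eplus S x) = eplus S x"
    and plus_star: "x \<in> carrier S \<Longrightarrow> eplus S (estar S x) = estar S x"

definition ehr_iso :: "'a ehr \<Rightarrow> 'b ehr \<Rightarrow> ('a \<Rightarrow> 'b) set" where
  "ehr_iso S S' = {h. bij_betw h (carrier S) (carrier S') \<and>
     (\<forall>x\<in>carrier S. \<forall>y\<in>carrier S. h (x \<cdot>\<^bsub>S\<^esub> y) = h x \<cdot>\<^bsub>S'\<^esub> h y) \<and>
     (\<forall>x\<in>carrier S. h (eplus S x) = eplus S' (h x)) \<and>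
     (\<forall>x\<in>carrier S. h (estar S x) = estar S' (h x))}"

definition ehr_isomorphic :: "'a ehr \<Rightarrow> 'b ehr \<Rightarrow> bool" where
  "ehr_isomorphic S S' \<longleftrightarrow> ehr_iso S S' \<noteq> {}"

definition projections :: "'a ehr \<Rightarrow> 'a set" where
  "projections S = eplus S ` carrier S"

definition proj_semilattice :: "'a ehr \<Rightarrow> 'a semigrp" where
  "proj_semilattice S = \<lparr>carrier = projections S, mul = mul S\<rparr>"

definition nat_le :: "'a ehr \<Rightarrow> 'a \<Rightarrow> 'a \<Rightarrow> bool" where
  "nat_le S a b \<longleftrightarrow> (\<exists>e\<in>projections S. \<exists>f\<in>projections S. a = e \<cdot>\<^bsub>S\<^esub> b \<cdot>\<^bsub>S\<^esub> f)"

definition ehr_congruence :: "'a ehr \<Rightarrow> ('a \<times> 'a) set \<Rightarrow> bool" where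
  "ehr_congruence S R \<longleftrightarrow> equiv (carrier S) R \<and>
     (\<forall>a b c d. (a, b) \<in> R \<and> (c, d) \<in> R \<longrightarrow> (a \<cdot>\<^bsub>S\<^esub> c, b \<cdot>\<^bsub>S\<^esub> d) \<in> R) \<and>
     (\<forall>a b. (a, b) \<in> R \<longrightarrow> (eplus S a, eplus S b) \<in> R \<and> (estar S a, estar S b) \<in> R)"

definition sigma :: "'a ehr \<Rightarrow> ('a \<times> 'a) set" where
  "sigma S = \<Inter>{R. ehr_congruence S R \<and> projections S \<times> projections S \<subseteq> R}"

definition sigma_quotient :: "'a ehr \<Rightarrow> 'a set monoid" where
  "sigma_quotient S =
     \<lparr>carrier = carrier S // sigma S,
      monoid.mult = (\<lambda>A B. \<Union>a\<in>A. \<Union>b\<in>B. sigma S `` {a \<cdot>\<^bsub>S\<^esub> b}),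
      one = (\<Union>e\<in>projections S. sigma S `` {e})\<rparr>"


section \<open>Proper Ehresmann semigroups\<close>

definition proper_element :: "'a ehr \<Rightarrow> 'a \<Rightarrow> bool" where
  "proper_element S s \<longleftrightarrow> s \<in> carrier S \<and>
     (\<forall>t\<in>carrier S. eplus S t = eplus S s \<and> estar S t = estar S s \<and> (t, s) \<in> sigma S \<longrightarrow> t = s)"

text \<open>The product of a non-empty list; no identity element is involved.\<close>

definition list_prod :: "('a \<Rightarrow> 'a \<Rightarrow> 'a) \<Rightarrow> 'a list \<Rightarrow> 'a" where
  "list_prod f xs = foldl f (hd xs) (tl xs)"

definition matching_factorization :: "'a ehr \<Rightarrow> 'a \<Rightarrow> 'a list \<Rightarrow> bool" where
  "matching_factorization S s xs \<longleftrightarrow> xs \<noteq> [] \<and> set xs \<subseteq> carrier S \<and> s = list_prod (mul S) xs \<and>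
     successively (\<lambda>x y. estar S x = eplus S y) xs"

definition factorizations_into :: "'a ehr \<Rightarrow> 'a set \<Rightarrow> 'a \<Rightarrow> 'a list set" where
  "factorizations_into S X s = {xs. matching_factorization S s xs \<and> set xs \<subseteq> X}"

text \<open>
  The relation \<open>\<rightarrow>\<close> and the equivalence it generates, on the matching factorizations of \<open>s\<close> into
  elements of a set \<open>X\<close> of proper elements of \<open>S\<close>. In the definition of a proper generating ideal \<open>Y\<close>
  these are used for \<open>X = Y\<close>: two factorizations into elements of \<open>Y\<close> are equivalent if they are
  connected by steps between factorizations into elements of \<open>Y\<close>. Allowing arbitrary proper
  elements in between would make uniqueness vacuous whenever \<open>s\<close> itself is proper (every
  factorization then reduces to the one-term factorization \<open>(s)\<close>), so that, for instance, in the
  free commutative monoid on \<open>a, b\<close> (with \<open>x\<^sup>+ = x\<^sup>* = 1\<close>) the set \<open>{1, a, b}\<close> would qualify,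
  although the algebra constructed from it below is the free monoid.
\<close>

definition fact_step :: "'a ehr \<Rightarrow> 'a set \<Rightarrow> 'a \<Rightarrow> ('a list \<times> 'a list) set" where
  "fact_step S X s = {(us @ ts @ vs, us @ [t] @ vs) | us ts vs t.
     us @ ts @ vs \<in> factorizations_into S X s \<and> ts \<noteq> [] \<and> t = list_prod (mul S) ts \<and> t \<in> X}"

definition fact_equiv :: "'a ehr \<Rightarrow> 'a set \<Rightarrow> 'a \<Rightarrow> ('a list \<times> 'a list) set" where
  "fact_equiv S X s = (fact_step S X s \<union> (fact_step S X s)\<inverse>)\<^sup>*"

definition proper_generating_ideal :: "'a ehr \<Rightarrow> 'a set \<Rightarrow> bool" where
  "proper_generating_ideal S Y \<longleftrightarrow>
     Y \<subseteq> carrier S \<and>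
     (\<forall>a\<in>carrier S. \<forall>b\<in>Y. nat_le S a b \<longrightarrow> a \<in> Y) \<and>
     projections S \<subseteq> Y \<and>
     (\<forall>y\<in>Y. proper_element S y) \<and>
     (\<forall>s\<in>carrier S. factorizations_into S Y s \<noteq> {} \<and>
        (\<forall>xs\<in>factorizations_into S Y s. \<forall>ys\<in>factorizations_into S Y s.
           (xs, ys) \<in> fact_equiv S Y s))"

definition proper_ehresmann_semigroup :: "'a ehr \<Rightarrow> bool" where
  "proper_ehresmann_semigroup S \<longleftrightarrow>
     ehresmann_semigroup S \<and> (\<exists>Y. proper_generating_ideal S Y)"


section \<open>Labelled graphs with restriction and corestriction\<close>

type_synonym ('v, 't) edge = "'v \<times> 't \<times> 'v"

definition edom :: "('v, 't) edge \<Rightarrow> 'v" where "edom c = fst c"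
definition elab :: "('v, 't) edge \<Rightarrow> 't" where "elab c = fst (snd c)"
definition eran :: "('v, 't) edge \<Rightarrow> 'v" where "eran c = snd (snd c)"

text \<open>
  \<open>res G g p\<close> is meaningful for edges \<open>p\<close> and vertices \<open>g \<le> edom p\<close>, and \<open>cores G p h\<close> for
  vertices \<open>h \<le> eran p\<close>.
\<close>

record ('v, 't) lgraph =
  verts :: "'v set"
  edges :: "('v, 't) edge set"
  res :: "'v \<Rightarrow> ('v, 't) edge \<Rightarrow> ('v, 't) edge"
  cores :: "('v, 't) edge \<Rightarrow> 'v \<Rightarrow> ('v, 't) edge"

definition edge_of :: "'a ehr \<Rightarrow> 'a \<Rightarrow> ('a, 'a set) edge" where
  "edge_of S a = (eplus S a, sigma S `` {a}, estar S a)"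

definition underlying_graph :: "'a ehr \<Rightarrow> 'a set \<Rightarrow> ('a, 'a set) lgraph" where
  "underlying_graph S Y =
     \<lparr>verts = projections S,
      edges = edge_of S ` Y,
      res = (\<lambda>g p. edge_of S (g \<cdot>\<^bsub>S\<^esub> the_inv_into Y (edge_of S) p)),
      cores = (\<lambda>p h. edge_of S (the_inv_into Y (edge_of S) p \<cdot>\<^bsub>S\<^esub> h))\<rparr>"

definition paths :: "('v, 't) lgraph \<Rightarrow> ('v, 't) edge list set" where
  "paths G = {p. p \<noteq> [] \<and> set p \<subseteq> edges G \<and> successively (\<lambda>c d. eran c = edom d) p}"

definition pdom :: "('v, 't) edge list \<Rightarrow> 'v" where "pdom p = edom (hd p)"
definition pran :: "('v, 't) edge list \<Rightarrow> 'v" where "pran p = eran (last p)"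

primrec path_res :: "('v, 't) lgraph \<Rightarrow> 'v \<Rightarrow> ('v, 't) edge list \<Rightarrow> ('v, 't) edge list" where
  "path_res G e [] = []"
| "path_res G e (c # p) = res G e c # path_res G (eran (res G e c)) p"

primrec path_cores :: "('v, 't) lgraph \<Rightarrow> ('v, 't) edge list \<Rightarrow> 'v \<Rightarrow> ('v, 't) edge list" where
  "path_cores G [] f = []"
| "path_cores G (c # p) f =
     (let q = path_cores G p f in cores G c (if q = [] then f else pdom q) # q)"


section \<open>The algebra constructed from a graph\<close>

text \<open>The congruence on the semicategory of paths; composition is concatenation.\<close>

inductive_set path_cong ::
    "'t monoid \<Rightarrow> ('v, 't) lgraph \<Rightarrow> (('v, 't) edge list \<times> ('v, 't) edge list) set"
  for T :: "'t monoid" and G :: "('v, 't) lgraph" where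
  gen: "\<lbrakk>p \<in> paths G; length p \<ge> 2;
         c = (pdom p, list_prod (monoid.mult T) (map elab p), pran p); c \<in> edges G\<rbrakk>
        \<Longrightarrow> (p, [c]) \<in> path_cong T G"
| refl: "p \<in> paths G \<Longrightarrow> (p, p) \<in> path_cong T G"
| sym: "(p, q) \<in> path_cong T G \<Longrightarrow> (q, p) \<in> path_cong T G"
| trans: "\<lbrakk>(p, q) \<in> path_cong T G; (q, r) \<in> path_cong T G\<rbrakk> \<Longrightarrow> (p, r) \<in> path_cong T G"
| comp: "\<lbrakk>(p, p') \<in> path_cong T G; (q, q') \<in> path_cong T G; pran p = pdom q\<rbrakk>
        \<Longrightarrow> (p @ q, p' @ q') \<in> path_cong T G"

text \<open>
  Arrows of the quotient semicategory are classes of paths. The operations on classes are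
  obtained from those on representatives, on which they do not depend.
\<close>

definition arr_dom :: "('v, 't) edge list set \<Rightarrow> 'v" where "arr_dom A = the_elem (pdom ` A)"
definition arr_ran :: "('v, 't) edge list set \<Rightarrow> 'v" where "arr_ran A = the_elem (pran ` A)"

definition arr_res ::
    "'t monoid \<Rightarrow> ('v, 't) lgraph \<Rightarrow> 'v \<Rightarrow> ('v, 't) edge list set \<Rightarrow> ('v, 't) edge list set" where
  "arr_res T G e A = (\<Union>p\<in>A. path_cong T G `` {path_res G e p})"

definition arr_cores ::
    "'t monoid \<Rightarrow> ('v, 't) lgraph \<Rightarrow> ('v, 't) edge list set \<Rightarrow> 'v \<Rightarrow> ('v, 't) edge list set" where
  "arr_cores T G A f = (\<Union>p\<in>A. path_cong T G `` {path_cores G p f})"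

definition arr_comp :: "'t monoid \<Rightarrow> ('v, 't) lgraph \<Rightarrow>
    ('v, 't) edge list set \<Rightarrow> ('v, 't) edge list set \<Rightarrow> ('v, 't) edge list set" where
  "arr_comp T G A B = (\<Union>p\<in>A. \<Union>q\<in>B. path_cong T G `` {p @ q})"

text \<open>\<open>graph_product E G T\<close> is \<open>E \<rtimes>\<^sub>G T\<close>.\<close>

definition graph_product ::
    "'v semigrp \<Rightarrow> ('v, 't) lgraph \<Rightarrow> 't monoid \<Rightarrow> ('v, 't) edge list set ehr" where
  "graph_product E G T =
     \<lparr>carrier = paths G // path_cong T G,
      mul = (\<lambda>A B. let m = arr_ran A \<cdot>\<^bsub>E\<^esub> arr_dom B
                   in arr_comp T G (arr_cores T G A m) (arr_res T G m B)),
      eplus = (\<lambda>A. path_cong T G `` {[(arr_dom A, one T, arr_dom A)]}),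
      estar = (\<lambda>A. path_cong T G `` {[(arr_ran A, one T, arr_ran A)]})\<rparr>"

end

theory Submission
  imports Defs
begin

text \<open>
  A path in the underlying graph is a word over the proper generating ideal \<open>Y\<close> in disguise: an
  element of \<open>Y\<close> is proper, hence determined by its edge, and consecutive edges are composable
  exactly when the word is matching. Multiplying out the word assigns to every path an element
  of \<open>S\<close>, and everything rests on the fact that this product is a complete invariant of the
  congruence on paths (\<open>path_cong_iff_word_product\<close>). Congruent paths have the same product since a
  generating pair replaces a path by an edge with the same ends and the same \<open>\<sigma>\<close>-class, and the
  element of \<open>Y\<close> behind that edge, being proper, can only be the product of the path. Conversely,
  two paths with the same product \<open>s\<close> are two factorizations of \<open>s\<close> into elements of \<open>Y\<close>; by
  uniqueness these are linked by contractions of subwords, and each contraction is an instance of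
  the congruence.

  The arrows of the quotient semicategory are therefore the sets of paths with a given product \<open>s\<close>,
  and there is one for every \<open>s\<close> because every element of \<open>S\<close> factorizes over \<open>Y\<close>. Restriction and
  corestriction multiply the product of a path by a projection from the left and from the right,
  so that the product of the arrows of \<open>s\<close> and \<open>t\<close> is the arrow of
  \<open>s m \<cdot> m t = s t\<close>, where \<open>m = s\<^sup>* t\<^sup>+\<close>.
\<close>

section \<open>Ehresmann semigroups and products of matching words\<close>

context ehresmann_semigroup
begin

lemma projections_closed: "e \<in> projections S \<Longrightarrow> e \<in> carrier S"
  by (auto simp: projections_def plus_closed)

lemma plus_in_projections: "x \<in> carrier S \<Longrightarrow> eplus S x \<in> projections S"
  by (auto simp: projections_def)

lemma star_in_projections: "x \<in> carrier S \<Longrightarrow> estar S x \<in> projections S"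
  by (metis plus_star star_closed plus_in_projections)

lemma projection_star: "e \<in> projections S \<Longrightarrow> estar S e = e"
  by (auto simp: projections_def star_plus)

lemma projection_plus: "e \<in> projections S \<Longrightarrow> eplus S e = e"
  by (metis plus_star projection_star projections_closed)

lemma projection_idem: "e \<in> projections S \<Longrightarrow> e \<cdot> e = e"
  by (metis plus_left projection_plus projections_closed)

lemma projections_mul:
  "\<lbrakk>e \<in> projections S; f \<in> projections S\<rbrakk> \<Longrightarrow> e \<cdot> f \<in> projections S"
  by (metis plus_mul_plus mul_closed projection_plus projections_closed plus_in_projections)

lemma plus_of_projection_mul:
  assumes "e \<in> projections S" "x \<in> carrier S"
  shows "eplus S (e \<cdot> x) = e \<cdot> eplus S x"
proof -
  have "e \<cdot> eplus S x \<in> projections S"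
    using assms by (simp add: projections_mul plus_in_projections)
  then show ?thesis
    using assms by (simp add: plus_mul[of e x] projections_closed projection_plus)
qed

lemma star_of_mul_projection:
  assumes "f \<in> projections S" "x \<in> carrier S"
  shows "estar S (x \<cdot> f) = estar S x \<cdot> f"
proof -
  have "estar S x \<cdot> f \<in> projections S"
    using assms by (simp add: projections_mul star_in_projections)
  then show ?thesis
    using assms by (simp add: star_mul[of x f] projections_closed projection_star)
qed

text \<open>The universal relation is a congruence identifying all projections, so the
  intersection defining \<open>\<sigma>\<close> is over a non-empty family.\<close>

lemma sigma_congruence: "ehr_congruence S (sigma S)"
proof -
  define F where "F = {R. ehr_congruence S R \<and> projections S \<times> projections S \<subseteq> R}"
  have sigma: "(a, b) \<in> sigma S \<longleftrightarrow> (\<forall>R\<in>F. (a, b) \<in> R)" for a b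
    by (simp add: sigma_def F_def)
  have univ: "carrier S \<times> carrier S \<in> F"
    unfolding F_def ehr_congruence_def equiv_def refl_on_def sym_on_def trans_on_def
    by (auto simp: mul_closed plus_closed star_closed projections_closed)
  have F: "equiv (carrier S) R"
      "\<And>a b c d. \<lbrakk>(a, b) \<in> R; (c, d) \<in> R\<rbrakk> \<Longrightarrow> (a \<cdot> c, b \<cdot> d) \<in> R"
      "\<And>a b. (a, b) \<in> R \<Longrightarrow> (eplus S a, eplus S b) \<in> R"
      "\<And>a b. (a, b) \<in> R \<Longrightarrow> (estar S a, estar S b) \<in> R"
    if "R \<in> F" for R
    using that unfolding F_def ehr_congruence_def by simp_all
  have "equiv (carrier S) (sigma S)"
  proof (rule equivI)
    show "sigma S \<subseteq> carrier S \<times> carrier S"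
      using univ sigma by auto
    show "refl_on (carrier S) (sigma S)"
      using F(1) by (auto simp: refl_on_def sigma equiv_def)
    show "sym (sigma S)"
      by (rule symI) (metis F(1) equivE symD sigma)
    show "trans (sigma S)"
      by (rule transI) (metis F(1) equivE transD sigma)
  qed
  then show ?thesis
    using F(2-4) unfolding ehr_congruence_def sigma by simp
qed

lemma sigma_equiv: "equiv (carrier S) (sigma S)"
  using sigma_congruence by (simp add: ehr_congruence_def)

lemma sigma_mul: "\<lbrakk>(a, b) \<in> sigma S; (c, d) \<in> sigma S\<rbrakk> \<Longrightarrow> (a \<cdot> c, b \<cdot> d) \<in> sigma S"
  using sigma_congruence by (auto simp: ehr_congruence_def)

lemma sigma_class_eq_iff:
  "\<lbrakk>a \<in> carrier S; b \<in> carrier S\<rbrakk> \<Longrightarrow> sigma S `` {a} = sigma S `` {b} \<longleftrightarrow> (a, b) \<in> sigma S"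
  by (rule eq_equiv_class_iff[OF sigma_equiv])

lemma sigma_projections:
  "\<lbrakk>e \<in> projections S; f \<in> projections S\<rbrakk> \<Longrightarrow> (e, f) \<in> sigma S"
  unfolding sigma_def by blast

lemma sigma_quotient_mult:
  assumes "a \<in> carrier S" "b \<in> carrier S"
  shows "monoid.mult (sigma_quotient S) (sigma S `` {a}) (sigma S `` {b}) = sigma S `` {a \<cdot> b}"
proof -
  have "sigma S `` {x \<cdot> y} = sigma S `` {a \<cdot> b}"
    if "x \<in> sigma S `` {a}" "y \<in> sigma S `` {b}" for x y
    using that sigma_mul equiv_class_eq[OF sigma_equiv] by blast
  then have "(\<Union>x\<in>sigma S `` {a}. \<Union>y\<in>sigma S `` {b}. sigma S `` {x \<cdot> y})
      = (\<Union>x\<in>sigma S `` {a}. \<Union>y\<in>sigma S `` {b}. sigma S `` {a \<cdot> b})"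
    by (intro SUP_cong HOL.refl)
  moreover have "sigma S `` {a} \<noteq> {}" "sigma S `` {b} \<noteq> {}"
    using assms equiv_class_self[OF sigma_equiv] by blast+
  ultimately show ?thesis
    by (simp add: sigma_quotient_def)
qed

lemma sigma_quotient_one:
  assumes "e \<in> projections S"
  shows "one (sigma_quotient S) = sigma S `` {e}"
proof -
  have "sigma S `` {f} = sigma S `` {e}" if "f \<in> projections S" for f
    using that assms by (metis sigma_class_eq_iff sigma_projections projections_closed)
  then have "(\<Union>f\<in>projections S. sigma S `` {f}) = (\<Union>f\<in>projections S. sigma S `` {e})"
    by (intro SUP_cong HOL.refl)
  moreover have "projections S \<noteq> {}"
    using assms by blast
  ultimately show ?thesis
    by (simp add: sigma_quotient_def)
qed

lemma edge_of_projection: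
  assumes "e \<in> projections S"
  shows "edge_of S e = (e, one (sigma_quotient S), e)"
  using assms by (simp add: edge_of_def projection_plus projection_star sigma_quotient_one)

abbreviation wprod :: "'a list \<Rightarrow> 'a" where
  "wprod \<equiv> list_prod (mul S)"

lemma foldl_mul:
  "\<lbrakk>x \<in> carrier S; y \<in> carrier S; set zs \<subseteq> carrier S\<rbrakk>
    \<Longrightarrow> foldl (mul S) (x \<cdot> y) zs = x \<cdot> foldl (mul S) y zs"
  by (induction zs arbitrary: y) (auto simp: mul_assoc mul_closed)

lemma wprod_single: "wprod [x] = x"
  by (simp add: list_prod_def)

lemma wprod_Cons:
  assumes "set (x # ys) \<subseteq> carrier S" "ys \<noteq> []"
  shows "wprod (x # ys) = x \<cdot> wprod ys"
  using assms by (cases ys) (auto simp: list_prod_def foldl_mul)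

lemma wprod_closed: "\<lbrakk>set xs \<subseteq> carrier S; xs \<noteq> []\<rbrakk> \<Longrightarrow> wprod xs \<in> carrier S"
  by (induction xs rule: induct_list012) (auto simp: wprod_single wprod_Cons mul_closed)

lemma wprod_append:
  assumes "set xs \<subseteq> carrier S" "set ys \<subseteq> carrier S" "xs \<noteq> []" "ys \<noteq> []"
  shows "wprod (xs @ ys) = wprod xs \<cdot> wprod ys"
  using assms
proof (induction xs rule: induct_list012)
  case (3 x y zs)
  let ?u = "wprod (y # zs)" and ?v = "wprod ys"
  have "wprod ((x # y # zs) @ ys) = x \<cdot> wprod ((y # zs) @ ys)"
    using 3(3,4) by (simp add: wprod_Cons)
  also have "\<dots> = x \<cdot> (?u \<cdot> ?v)"
    using 3 by simp
  also have "\<dots> = (x \<cdot> ?u) \<cdot> ?v"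
    using 3(3-6) by (intro mul_assoc[symmetric] wprod_closed) auto
  also have "x \<cdot> ?u = wprod (x # y # zs)"
    using 3(3) by (simp add: wprod_Cons)
  finally show ?case .
qed (simp_all add: wprod_single wprod_Cons)

lemma sigma_class_wprod:
  assumes "set xs \<subseteq> carrier S" "xs \<noteq> []"
  shows "list_prod (monoid.mult (sigma_quotient S)) (map (\<lambda>x. sigma S `` {x}) xs)
           = sigma S `` {wprod xs}"
proof -
  have "foldl (monoid.mult (sigma_quotient S)) (sigma S `` {y}) (map (\<lambda>x. sigma S `` {x}) ys)
          = sigma S `` {foldl (mul S) y ys}"
    if "y \<in> carrier S" "set ys \<subseteq> carrier S" for y ys
    using that by (induction ys arbitrary: y) (auto simp: sigma_quotient_mult mul_closed)
  then show ?thesis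
    using assms by (cases xs) (auto simp: list_prod_def)
qed

abbreviation matching :: "'a list \<Rightarrow> bool" where
  "matching \<equiv> successively (\<lambda>x y. estar S x = eplus S y)"

text \<open>In a matching word \<open>x\<^sub>1 \<dots> x\<^sub>n\<close>, every letter but the last has \<open>(x\<^sub>i y)\<^sup>+ = (x\<^sub>i x\<^sub>i\<^sup>*)\<^sup>+ = x\<^sub>i\<^sup>+\<close> for the
  product \<open>y\<close> of the letters behind it, so only the outermost ends of the word remain visible.\<close>

lemma plus_wprod:
  assumes "set xs \<subseteq> carrier S" "xs \<noteq> []" "matching xs"
  shows "eplus S (wprod xs) = eplus S (hd xs)"
  using assms
proof (induction xs rule: induct_list012)
  case (3 x y zs)
  have "eplus S (wprod (x # y # zs)) = eplus S (x \<cdot> eplus S (wprod (y # zs)))"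
    using 3 plus_mul[of x "wprod (y # zs)"] by (simp add: wprod_Cons wprod_closed)
  also have "\<dots> = eplus S (x \<cdot> estar S x)"
    using 3 by simp
  also have "\<dots> = eplus S x"
    using 3(3) plus_mul[of x "estar S x", symmetric] by (simp add: star_right star_closed plus_star)
  finally show ?case by simp
qed (auto simp: wprod_single)

lemma star_wprod:
  assumes "set xs \<subseteq> carrier S" "xs \<noteq> []" "matching xs"
  shows "estar S (wprod xs) = estar S (last xs)"
  using assms
proof (induction xs rule: induct_list012)
  case (3 x y zs)
  have "estar S (wprod (x # y # zs)) = estar S (estar S x \<cdot> wprod (y # zs))"
    using 3 star_mul[of x "wprod (y # zs)"] by (simp add: wprod_Cons wprod_closed)
  also have "estar S x = eplus S (wprod (y # zs))"
    using 3 plus_wprod[of "y # zs"] by simp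
  finally show ?case
    using 3 by (simp add: plus_left wprod_closed)
qed (auto simp: wprod_single)

end


section \<open>Paths as words over the generating ideal\<close>

locale proper_generated = ehresmann_semigroup +
  fixes Y :: "'a set"
  assumes generating: "proper_generating_ideal S Y"
begin

abbreviation G :: "('a, 'a set) lgraph" where
  "G \<equiv> underlying_graph S Y"

abbreviation T :: "'a set monoid" where
  "T \<equiv> sigma_quotient S"

definition words :: "'a list set" where
  "words = {xs. xs \<noteq> [] \<and> set xs \<subseteq> Y \<and> matching xs}"

abbreviation path_of :: "'a list \<Rightarrow> ('a, 'a set) edge list" where
  "path_of \<equiv> map (edge_of S)"

lemma Y_closed: "y \<in> Y \<Longrightarrow> y \<in> carrier S"
  using generating by (auto simp: proper_generating_ideal_def)

lemma projections_in_Y: "e \<in> projections S \<Longrightarrow> e \<in> Y"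
  using generating by (auto simp: proper_generating_ideal_def)

lemma Y_proper:
  assumes "y \<in> Y" "t \<in> carrier S"
    and "eplus S t = eplus S y" "estar S t = estar S y" "(t, y) \<in> sigma S"
  shows "t = y"
proof -
  have "proper_element S y"
    using generating assms(1) by (simp add: proper_generating_ideal_def)
  then have "eplus S t = eplus S y \<and> estar S t = estar S y \<and> (t, y) \<in> sigma S \<longrightarrow> t = y"
    using assms(2) unfolding proper_element_def by (elim conjE) (erule bspec)
  then show ?thesis
    by (rule mp) (use assms in simp)
qed

lemma Y_ideal: "\<lbrakk>a \<in> carrier S; b \<in> Y; nat_le S a b\<rbrakk> \<Longrightarrow> a \<in> Y"
  using generating by (auto simp: proper_generating_ideal_def)

lemma projection_mul_in_Y:
  assumes "e \<in> projections S" "y \<in> Y"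
  shows "e \<cdot> y \<in> Y"
proof (rule Y_ideal)
  show "e \<cdot> y \<in> carrier S" "y \<in> Y"
    using assms by (simp_all add: mul_closed projections_closed Y_closed)
  have "e \<cdot> y = e \<cdot> y \<cdot> estar S y"
    using assms by (simp add: mul_assoc projections_closed Y_closed star_closed star_right)
  then show "nat_le S (e \<cdot> y) y"
    using assms Y_closed star_in_projections unfolding nat_le_def by blast
qed

lemma mul_projection_in_Y:
  assumes "f \<in> projections S" "y \<in> Y"
  shows "y \<cdot> f \<in> Y"
proof (rule Y_ideal)
  show "y \<cdot> f \<in> carrier S" "y \<in> Y"
    using assms by (simp_all add: mul_closed projections_closed Y_closed)
  have "y \<cdot> f = eplus S y \<cdot> y \<cdot> f"
    using assms by (simp add: Y_closed plus_left)
  then show "nat_le S (y \<cdot> f) y"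
    using assms Y_closed plus_in_projections unfolding nat_le_def by blast
qed

lemma words_closed: "xs \<in> words \<Longrightarrow> set xs \<subseteq> carrier S"
  using Y_closed by (auto simp: words_def)

lemma words_nonempty: "xs \<in> words \<Longrightarrow> xs \<noteq> []"
  by (simp add: words_def)

lemma words_wprod_closed: "xs \<in> words \<Longrightarrow> wprod xs \<in> carrier S"
  by (simp add: words_closed words_nonempty wprod_closed)

lemma words_plus: "xs \<in> words \<Longrightarrow> eplus S (wprod xs) = eplus S (hd xs)"
  using words_closed plus_wprod by (simp add: words_def)

lemma words_star: "xs \<in> words \<Longrightarrow> estar S (wprod xs) = estar S (last xs)"
  using words_closed star_wprod by (simp add: words_def)

lemma words_single: "y \<in> Y \<Longrightarrow> [y] \<in> words"
  by (simp add: words_def)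

lemma words_Cons:
  "ys \<noteq> [] \<Longrightarrow> x # ys \<in> words \<longleftrightarrow> x \<in> Y \<and> ys \<in> words \<and> estar S x = eplus S (hd ys)"
  by (cases ys) (auto simp: words_def)

lemma words_append:
  "\<lbrakk>xs \<noteq> []; ys \<noteq> []\<rbrakk> \<Longrightarrow>
     xs @ ys \<in> words \<longleftrightarrow> xs \<in> words \<and> ys \<in> words \<and> estar S (last xs) = eplus S (hd ys)"
  by (auto simp: words_def successively_append_iff)

lemma words_append_iff_ends:
  "\<lbrakk>xs \<in> words; ys \<in> words\<rbrakk> \<Longrightarrow>
     xs @ ys \<in> words \<longleftrightarrow> estar S (wprod xs) = eplus S (wprod ys)"
  by (simp add: words_append words_nonempty words_plus words_star)

lemma factorizations_iff_words:
  "xs \<in> factorizations_into S Y s \<longleftrightarrow> xs \<in> words \<and> wprod xs = s"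
  using Y_closed by (auto simp: factorizations_into_def matching_factorization_def words_def)

lemma edge_of_inj: "inj_on (edge_of S) Y"
proof (rule inj_onI)
  fix a b assume "a \<in> Y" "b \<in> Y" and eq: "edge_of S a = edge_of S b"
  moreover have "(a, b) \<in> sigma S"
    using calculation sigma_class_eq_iff Y_closed by (simp add: edge_of_def)
  ultimately show "a = b"
    using Y_proper[of b a] Y_closed[of a] by (simp add: edge_of_def)
qed

lemma path_of_inj: "\<lbrakk>xs \<in> words; ys \<in> words; path_of xs = path_of ys\<rbrakk> \<Longrightarrow> xs = ys"
  by (rule map_inj_on[of "edge_of S"])
     (auto simp: words_def intro: inj_on_subset[OF edge_of_inj])

lemma pdom_path_of: "xs \<in> words \<Longrightarrow> pdom (path_of xs) = eplus S (wprod xs)"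
  using words_plus[of xs] words_nonempty[of xs]
  by (simp add: pdom_def list.map_sel edom_def edge_of_def)

lemma pran_path_of: "xs \<in> words \<Longrightarrow> pran (path_of xs) = estar S (wprod xs)"
  using words_star[of xs] words_nonempty[of xs]
  by (simp add: pran_def last_map eran_def edge_of_def)

lemma paths_eq_words: "paths G = path_of ` words"
proof
  show "path_of ` words \<subseteq> paths G"
    by (auto simp: paths_def words_def underlying_graph_def successively_map
        edge_of_def[of S] edom_def eran_def intro!: imageI)
  show "paths G \<subseteq> path_of ` words"
  proof
    fix p assume p: "p \<in> paths G"
    then have "p \<in> lists (edge_of S ` Y)"
      by (auto simp: paths_def underlying_graph_def)
    then obtain xs where "set xs \<subseteq> Y" "p = path_of xs"
      by (auto simp: lists_image)
    then show "p \<in> path_of ` words"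
      using p by (auto simp: paths_def words_def successively_map edge_of_def edom_def eran_def)
  qed
qed

lemma elab_path_of: "map elab (path_of xs) = map (\<lambda>x. sigma S `` {x}) xs"
  by (simp add: edge_of_def elab_def)

lemma path_of_in_paths: "xs \<in> words \<Longrightarrow> path_of xs \<in> paths G"
  by (simp add: paths_eq_words)


section \<open>The path congruence is equality of products\<close>

text \<open>A generating pair of the congruence never changes the product: the element \<open>y\<close> of \<open>Y\<close>
  that labels the new edge has the same ends and the same \<open>\<sigma>\<close>-class as the product of the word,
  hence equals it because \<open>y\<close> is proper.\<close>

lemma parallel_edge_is_wprod:
  assumes "xs \<in> words" "y \<in> Y"
    and "edge_of S y = (pdom (path_of xs),
           list_prod (monoid.mult T) (map elab (path_of xs)), pran (path_of xs))"
  shows "y = wprod xs"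
proof -
  have "sigma S `` {y} = sigma S `` {wprod xs}"
    and "eplus S y = eplus S (wprod xs)" "estar S y = estar S (wprod xs)"
    using assms(1) assms(3)[unfolded elab_path_of]
    by (simp_all add: edge_of_def[of S y] sigma_class_wprod words_closed words_nonempty
        pdom_path_of pran_path_of)
  moreover have "(wprod xs, y) \<in> sigma S"
    using calculation sigma_class_eq_iff words_wprod_closed[OF assms(1)] Y_closed[OF assms(2)]
    by metis
  ultimately show ?thesis
    using Y_proper[OF assms(2) words_wprod_closed[OF assms(1)]] by simp
qed

lemma path_cong_same_product:
  assumes "(p, q) \<in> path_cong T G"
  shows "\<exists>xs\<in>words. \<exists>ys\<in>words. p = path_of xs \<and> q = path_of ys \<and> wprod xs = wprod ys"
  using assms
proof (induction rule: path_cong.induct)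
  case (gen p c)
  obtain xs where xs: "xs \<in> words" "p = path_of xs"
    using gen by (auto simp: paths_eq_words)
  obtain y where y: "y \<in> Y" "c = edge_of S y"
    using gen by (auto simp: underlying_graph_def)
  have "y = wprod xs"
    using parallel_edge_is_wprod xs y gen by simp
  then show ?case
    using xs y words_single wprod_single by (intro bexI[of _ xs] bexI[of _ "[y]"]) auto
next
  case (refl p)
  then show ?case by (auto simp: paths_eq_words)
next
  case (sym p q)
  then show ?case by metis
next
  case (trans p q r)
  then show ?case by (metis path_of_inj)
next
  case (comp p p' q q')
  obtain xs xs' ys ys' where
    w: "xs \<in> words" "xs' \<in> words" "ys \<in> words" "ys' \<in> words"
    and p: "p = path_of xs" "p' = path_of xs'" "q = path_of ys" "q' = path_of ys'"
    and eq: "wprod xs = wprod xs'" "wprod ys = wprod ys'"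
    using comp.IH by metis
  have "estar S (wprod xs) = eplus S (wprod ys)"
    using comp.hyps w p by (simp add: pdom_path_of pran_path_of)
  then have "xs @ ys \<in> words" "xs' @ ys' \<in> words"
    using w eq by (simp_all add: words_append_iff_ends)
  then show ?case
    using w p eq by (intro bexI[of _ "xs @ ys"] bexI[of _ "xs' @ ys'"])
      (simp_all add: wprod_append words_closed words_nonempty)
qed

lemma path_cong_append:
  assumes "(path_of us, path_of us') \<in> path_cong T G" "us \<in> words"
    and "(path_of vs, path_of vs') \<in> path_cong T G" "vs \<in> words" "us @ vs \<in> words"
  shows "(path_of (us @ vs), path_of (us' @ vs')) \<in> path_cong T G"
proof -
  have "pran (path_of us) = pdom (path_of vs)"
    using assms(2,4,5) by (simp add: pran_path_of pdom_path_of words_append_iff_ends)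
  then show ?thesis
    using path_cong.comp[OF assms(1,3)] by simp
qed

text \<open>A word of length one is its own contraction and is not a generating pair, hence the case
  distinction.\<close>

lemma path_cong_contract:
  assumes "ts \<in> words" "wprod ts \<in> Y"
  shows "(path_of ts, path_of [wprod ts]) \<in> path_cong T G"
proof (cases "length ts \<ge> 2")
  case True
  have edge: "edge_of S (wprod ts) = (pdom (path_of ts),
           list_prod (monoid.mult T) (map elab (path_of ts)), pran (path_of ts))"
    using assms(1) unfolding elab_path_of
    by (simp add: sigma_class_wprod words_closed words_nonempty pdom_path_of pran_path_of
        edge_of_def[of S "wprod ts"])
  have "edge_of S (wprod ts) \<in> edges G"
    using assms(2) by (simp add: underlying_graph_def)
  then have "(path_of ts, [edge_of S (wprod ts)]) \<in> path_cong T G"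
    using True path_of_in_paths[OF assms(1)] edge by (intro path_cong.gen) simp_all
  then show ?thesis by simp
next
  case False
  then obtain t where "ts = [t]"
    using words_nonempty[OF assms(1)] by (cases ts) (auto simp: Suc_le_eq)
  then show ?thesis
    using path_cong.refl[OF path_of_in_paths[OF assms(1)]] by (simp add: wprod_single)
qed

text \<open>A step between factorizations contracts a subword \<open>ts\<close>, and congruence carries the contraction
  of \<open>ts\<close> to the whole path. The margins \<open>us\<close> and \<open>vs\<close> may be empty, while only non-empty
  paths compose, so they are attached one at a time.\<close>

lemma fact_step_path_cong:
  assumes "(xs, ys) \<in> fact_step S Y s"
  shows "(path_of xs, path_of ys) \<in> path_cong T G"
proof -
  obtain us ts vs where xs: "xs = us @ ts @ vs" and ys: "ys = us @ [wprod ts] @ vs"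
    and w: "us @ ts @ vs \<in> words" and ts: "ts \<noteq> []" "wprod ts \<in> Y"
    using assms by (auto simp: fact_step_def factorizations_iff_words)
  have tvw: "ts @ vs \<in> words"
    using w ts by (cases "us = []") (auto simp: words_append)
  then have tw: "ts \<in> words"
    using ts by (cases "vs = []") (auto simp: words_append)
  note ct = path_cong_contract[OF tw ts(2)]
  have "(path_of (ts @ vs), path_of ([wprod ts] @ vs)) \<in> path_cong T G"
  proof (cases "vs = []")
    case False
    then have vw: "vs \<in> words" using tvw ts words_append by blast
    show ?thesis
      by (rule path_cong_append[OF ct tw path_cong.refl[OF path_of_in_paths[OF vw]] vw tvw])
  qed (use ct in simp)
  note ctv = this
  show ?thesis
  proof (cases "us = []")
    case False
    then have uw: "us \<in> words" using w ts words_append by blast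
    show ?thesis
      unfolding xs ys
      by (rule path_cong_append[OF path_cong.refl[OF path_of_in_paths[OF uw]] uw ctv tvw w])
  qed (use ctv xs ys in simp)
qed

lemma same_product_path_cong:
  assumes "xs \<in> words" "ys \<in> words" "wprod xs = wprod ys"
  shows "(path_of xs, path_of ys) \<in> path_cong T G"
proof -
  let ?s = "wprod xs"
  have "(xs, ys) \<in> fact_equiv S Y ?s"
    using generating assms words_wprod_closed[OF assms(1)]
    by (simp add: proper_generating_ideal_def factorizations_iff_words)
  then have "(xs, ys) \<in> (fact_step S Y ?s \<union> (fact_step S Y ?s)\<inverse>)\<^sup>*"
    by (simp add: fact_equiv_def)
  then show ?thesis
  proof (induction rule: rtrancl_induct)
    case base
    then show ?case
      using assms path_of_in_paths path_cong.refl by blast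
  next
    case (step y z)
    then show ?case
      using fact_step_path_cong path_cong.sym path_cong.trans by blast
  qed
qed

lemma path_cong_iff_word_product:
  assumes "xs \<in> words" "ys \<in> words"
  shows "(path_of xs, path_of ys) \<in> path_cong T G \<longleftrightarrow> wprod xs = wprod ys"
proof
  assume "(path_of xs, path_of ys) \<in> path_cong T G"
  then obtain us vs where "us \<in> words" "vs \<in> words" "path_of xs = path_of us"
      "path_of ys = path_of vs" "wprod us = wprod vs"
    using path_cong_same_product by metis
  then show "wprod xs = wprod ys"
    using assms path_of_inj[of xs us] path_of_inj[of ys vs] by simp
qed (use assms same_product_path_cong in blast)


section \<open>Restriction and corestriction multiply by projections\<close>

lemma res_edge_of: "x \<in> Y \<Longrightarrow> res G e (edge_of S x) = edge_of S (e \<cdot> x)"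
  by (simp add: underlying_graph_def the_inv_into_f_f[OF edge_of_inj])

lemma eran_edge_of: "eran (edge_of S x) = estar S x"
  by (simp add: eran_def edge_of_def)

lemma cores_edge_of: "x \<in> Y \<Longrightarrow> cores G (edge_of S x) f = edge_of S (x \<cdot> f)"
  by (simp add: underlying_graph_def the_inv_into_f_f[OF edge_of_inj])

text \<open>Pushing a projection \<open>e\<close> through \<open>x\<close> leaves \<open>g = (e x)\<^sup>*\<close> on its right, and
  \<open>e x = e x g\<close>; so the restricted letters still multiply to \<open>e\<close> times the
  original product. They match again because \<open>g \<le> x\<^sup>*\<close>, the left end of the next letter.\<close>

lemma path_res_path_of:
  assumes "xs \<in> words" "e \<in> projections S" "e \<cdot> eplus S (wprod xs) = e"
  shows "\<exists>ys\<in>words. path_res G e (path_of xs) = path_of ys \<and> wprod ys = e \<cdot> wprod xs"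
  using assms
proof (induction xs arbitrary: e rule: induct_list012)
  case 1
  then show ?case by (simp add: words_def)
next
  case (2 x)
  then have "x \<in> Y" by (simp add: words_def)
  then show ?case
    using 2 words_single[OF projection_mul_in_Y[of e x]]
    by (intro bexI[of _ "[e \<cdot> x]"]) (auto simp: res_edge_of wprod_single)
next
  case (3 x y zs)
  let ?g = "estar S (e \<cdot> x)" and ?t = "wprod (y # zs)"
  have x: "x \<in> Y" and w: "y # zs \<in> words" and m: "estar S x = eplus S y"
    using 3(3) by (auto simp: words_Cons)
  have cl: "x \<in> carrier S" "e \<in> carrier S" "?t \<in> carrier S" "e \<cdot> x \<in> carrier S"
    using x w 3(4) by (simp_all add: Y_closed words_wprod_closed projections_closed mul_closed)
  have g: "?g \<in> projections S"
    using cl by (simp add: star_in_projections)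
  have tplus: "eplus S ?t = estar S x"
    using words_plus[OF w] m by simp
  have gx: "?g \<cdot> estar S x = ?g"
    using cl star_of_mul_projection[of "estar S x" "e \<cdot> x"]
    by (simp add: star_in_projections mul_assoc star_right star_closed)
  obtain ys where ys: "ys \<in> words" "path_res G ?g (path_of (y # zs)) = path_of ys"
      "wprod ys = ?g \<cdot> ?t"
    using 3(2)[OF w g] gx tplus by auto
  have "eplus S (hd ys) = ?g"
    using words_plus[OF ys(1)] ys(3) plus_of_projection_mul[OF g cl(3)] tplus gx by simp
  then have w': "(e \<cdot> x) # ys \<in> words"
    using ys(1) words_nonempty projection_mul_in_Y[OF 3(4) x] by (simp add: words_Cons)
  have "path_res G e (path_of (x # y # zs)) = path_of ((e \<cdot> x) # ys)"
    using ys(2) x by (simp add: res_edge_of eran_edge_of)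
  moreover have "wprod ((e \<cdot> x) # ys) = e \<cdot> wprod (x # y # zs)"
  proof -
    have "wprod ((e \<cdot> x) # ys) = (e \<cdot> x) \<cdot> (?g \<cdot> ?t)"
      using words_closed[OF w'] words_nonempty[OF ys(1)] ys(3) by (simp add: wprod_Cons)
    also have "\<dots> = (e \<cdot> x) \<cdot> ?t"
      using cl g by (metis mul_assoc star_right projections_closed)
    also have "\<dots> = e \<cdot> wprod (x # y # zs)"
      using cl words_closed[OF 3(3)] by (simp add: wprod_Cons mul_assoc)
    finally show ?thesis .
  qed
  ultimately show ?case using w' by blast
qed

text \<open>On the other side it is \<open>(t f)\<^sup>+\<close> that passes through the letter \<open>x\<close> in front of \<open>t\<close>,
  and \<open>x (t f)\<^sup>+ (t f) = x t f\<close>.\<close>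

lemma path_cores_path_of:
  assumes "xs \<in> words" "f \<in> projections S" "estar S (wprod xs) \<cdot> f = f"
  shows "\<exists>ys\<in>words. path_cores G (path_of xs) f = path_of ys \<and> wprod ys = wprod xs \<cdot> f"
  using assms
proof (induction xs rule: induct_list012)
  case 1
  then show ?case by (simp add: words_def)
next
  case (2 x)
  then have "x \<in> Y" by (simp add: words_def)
  then show ?case
    using 2 words_single[OF mul_projection_in_Y[of f x]]
    by (intro bexI[of _ "[x \<cdot> f]"]) (auto simp: cores_edge_of wprod_single)
next
  case (3 x y zs)
  let ?t = "wprod (y # zs)"
  let ?g = "eplus S (?t \<cdot> f)"
  have x: "x \<in> Y" and w: "y # zs \<in> words" and m: "estar S x = eplus S y"
    using 3(3) by (auto simp: words_Cons)
  have cl: "x \<in> carrier S" "f \<in> carrier S" "?t \<in> carrier S" "?t \<cdot> f \<in> carrier S"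
    using x w 3(4) by (simp_all add: Y_closed words_wprod_closed projections_closed mul_closed)
  have g: "?g \<in> projections S"
    using cl by (simp add: plus_in_projections)
  have tplus: "eplus S ?t = estar S x"
    using words_plus[OF w] m by simp
  have gx: "estar S x \<cdot> ?g = ?g"
    using cl plus_of_projection_mul[of "estar S x" "?t \<cdot> f"]
    by (metis mul_assoc plus_left star_closed star_in_projections tplus)
  have "estar S ?t \<cdot> f = f"
    using 3(5) words_star[OF w] words_star[OF 3(3)] by simp
  then obtain ys where ys: "ys \<in> words" "path_cores G (path_of (y # zs)) f = path_of ys"
      "wprod ys = ?t \<cdot> f"
    using 3(2)[OF w 3(4)] by auto
  have "estar S (x \<cdot> ?g) = eplus S (hd ys)"
    using words_plus[OF ys(1)] ys(3) star_of_mul_projection[OF g cl(1)] gx by simp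
  then have w': "(x \<cdot> ?g) # ys \<in> words"
    using ys(1) words_nonempty mul_projection_in_Y[OF g x] by (simp add: words_Cons)
  have "path_cores G (path_of (x # y # zs)) f
      = (let q = path_cores G (path_of (y # zs)) f
         in cores G (edge_of S x) (if q = [] then f else pdom q) # q)"
    by simp
  also have "\<dots> = path_of ((x \<cdot> ?g) # ys)"
    unfolding ys(2) using x words_nonempty[OF ys(1)] ys(3) pdom_path_of[OF ys(1)]
    by (simp add: cores_edge_of)
  finally have "path_cores G (path_of (x # y # zs)) f = path_of ((x \<cdot> ?g) # ys)" .
  moreover have "wprod ((x \<cdot> ?g) # ys) = wprod (x # y # zs) \<cdot> f"
  proof -
    have "wprod ((x \<cdot> ?g) # ys) = (x \<cdot> ?g) \<cdot> (?t \<cdot> f)"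
      using words_closed[OF w'] words_nonempty[OF ys(1)] ys(3) by (simp add: wprod_Cons)
    also have "\<dots> = x \<cdot> (?t \<cdot> f)"
      using cl g by (simp add: mul_assoc plus_left projections_closed)
    also have "\<dots> = wprod (x # y # zs) \<cdot> f"
      using cl words_closed[OF 3(3)] by (simp add: wprod_Cons mul_assoc)
    finally show ?thesis .
  qed
  ultimately show ?case using w' by blast
qed


section \<open>The isomorphism\<close>

text \<open>These sets turn out to be the classes of the path congruence; in this form they are indexed
  by the elements of \<open>S\<close>, which makes the isomorphism explicit.\<close>

definition arrow :: "'a \<Rightarrow> ('a, 'a set) edge list set" where
  "arrow s = path_of ` factorizations_into S Y s"

lemma arrow_iff: "p \<in> arrow s \<longleftrightarrow> (\<exists>xs\<in>words. p = path_of xs \<and> wprod xs = s)"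
  by (auto simp: arrow_def factorizations_iff_words)

lemma word_exists:
  assumes "s \<in> carrier S"
  obtains xs where "xs \<in> words" "wprod xs = s"
proof -
  have "factorizations_into S Y s \<noteq> {}"
    using generating assms by (simp add: proper_generating_ideal_def)
  then show thesis using that factorizations_iff_words by blast
qed

lemma path_class:
  assumes "xs \<in> words"
  shows "path_cong T G `` {path_of xs} = arrow (wprod xs)"
proof
  show "path_cong T G `` {path_of xs} \<subseteq> arrow (wprod xs)"
  proof
    fix q assume "q \<in> path_cong T G `` {path_of xs}"
    then have pq: "(path_of xs, q) \<in> path_cong T G" by simp
    then obtain ys where ys: "ys \<in> words" "q = path_of ys"
      using path_cong_same_product by metis
    then have "wprod ys = wprod xs"
      using pq path_cong_iff_word_product[OF assms ys(1)] by simp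
    then show "q \<in> arrow (wprod xs)"
      using ys arrow_iff by blast
  qed
  show "arrow (wprod xs) \<subseteq> path_cong T G `` {path_of xs}"
    using path_cong_iff_word_product[OF assms] by (auto simp: arrow_iff)
qed

text \<open>The operations on arrows are unions over all representatives. Such a union collapses to one
  arrow as soon as the resulting paths all have the same product.\<close>

lemma Union_path_class:
  assumes "p\<^sub>0 \<in> A" "\<And>p. p \<in> A \<Longrightarrow> \<exists>ys\<in>words. f p = path_of ys \<and> wprod ys = s"
  shows "(\<Union>p\<in>A. path_cong T G `` {f p}) = arrow s"
proof -
  have "path_cong T G `` {f p} = arrow s" if p: "p \<in> A" for p
  proof -
    obtain ys where "ys \<in> words" "f p = path_of ys" "wprod ys = s"
      using assms(2)[OF p] by blast
    then show ?thesis
      using path_class[of ys] by simp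
  qed
  then have "(\<Union>p\<in>A. path_cong T G `` {f p}) = (\<Union>p\<in>A. arrow s)"
    by (intro SUP_cong HOL.refl)
  then show ?thesis using assms(1) by auto
qed

lemma arrow_nonempty:
  assumes "s \<in> carrier S"
  shows "\<exists>p. p \<in> arrow s"
proof -
  obtain xs where "xs \<in> words" "wprod xs = s"
    using word_exists[OF assms] .
  then show ?thesis
    using arrow_iff by blast
qed

lemma arr_dom_arrow:
  assumes "s \<in> carrier S"
  shows "arr_dom (arrow s) = eplus S s"
proof -
  have "pdom p = eplus S s" if "p \<in> arrow s" for p
    using that by (auto simp: arrow_iff pdom_path_of)
  then have "pdom ` arrow s = {eplus S s}"
    using arrow_nonempty[OF assms] by force
  then show ?thesis by (simp add: arr_dom_def)
qed

lemma arr_ran_arrow: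
  assumes "s \<in> carrier S"
  shows "arr_ran (arrow s) = estar S s"
proof -
  have "pran p = estar S s" if "p \<in> arrow s" for p
    using that by (auto simp: arrow_iff pran_path_of)
  then have "pran ` arrow s = {estar S s}"
    using arrow_nonempty[OF assms] by force
  then show ?thesis by (simp add: arr_ran_def)
qed

lemma arr_res_arrow:
  assumes "s \<in> carrier S" "e \<in> projections S" "e \<cdot> eplus S s = e"
  shows "arr_res T G e (arrow s) = arrow (e \<cdot> s)"
proof -
  obtain p where p: "p \<in> arrow s" using arrow_nonempty assms by blast
  show ?thesis
    unfolding arr_res_def
  proof (rule Union_path_class[OF p])
    fix q assume "q \<in> arrow s"
    then obtain xs where "xs \<in> words" "q = path_of xs" "wprod xs = s"
      by (auto simp: arrow_iff)
    then show "\<exists>ys\<in>words. path_res G e q = path_of ys \<and> wprod ys = e \<cdot> s"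
      using assms path_res_path_of[of xs e] by simp
  qed
qed

lemma arr_cores_arrow:
  assumes "s \<in> carrier S" "f \<in> projections S" "estar S s \<cdot> f = f"
  shows "arr_cores T G (arrow s) f = arrow (s \<cdot> f)"
proof -
  obtain p where p: "p \<in> arrow s" using arrow_nonempty assms by blast
  show ?thesis
    unfolding arr_cores_def
  proof (rule Union_path_class[OF p])
    fix q assume "q \<in> arrow s"
    then obtain xs where "xs \<in> words" "q = path_of xs" "wprod xs = s"
      by (auto simp: arrow_iff)
    then show "\<exists>ys\<in>words. path_cores G q f = path_of ys \<and> wprod ys = s \<cdot> f"
      using assms path_cores_path_of[of xs f] by simp
  qed
qed

lemma arr_comp_arrow:
  assumes "s \<in> carrier S" "t \<in> carrier S" "estar S s = eplus S t"
  shows "arr_comp T G (arrow s) (arrow t) = arrow (s \<cdot> t)"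
proof -
  obtain p q where p: "p \<in> arrow s" and q: "q \<in> arrow t"
    using arrow_nonempty[OF assms(1)] arrow_nonempty[OF assms(2)] by blast
  have "\<exists>zs\<in>words. p @ q = path_of zs \<and> wprod zs = s \<cdot> t"
    if pq: "p \<in> arrow s" "q \<in> arrow t" for p q
  proof -
    obtain xs ys where w: "xs \<in> words" "ys \<in> words" "p = path_of xs" "q = path_of ys"
        "wprod xs = s" "wprod ys = t"
      using pq by (auto simp: arrow_iff)
    then have "xs @ ys \<in> words"
      using assms(3) by (simp add: words_append_iff_ends)
    then show ?thesis
      using w by (intro bexI[of _ "xs @ ys"])
        (simp_all add: wprod_append words_closed words_nonempty)
  qed
  then have "(\<Union>r\<in>arrow s \<times> arrow t. path_cong T G `` {fst r @ snd r}) = arrow (s \<cdot> t)"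
    using p q by (intro Union_path_class[of "(p, q)"]) auto
  moreover have "arr_comp T G (arrow s) (arrow t)
      = (\<Union>r\<in>arrow s \<times> arrow t. path_cong T G `` {fst r @ snd r})"
    unfolding arr_comp_def by fastforce
  ultimately show ?thesis
    by simp
qed

abbreviation product_algebra :: "('a, 'a set) edge list set ehr" where
  "product_algebra \<equiv> graph_product (proj_semilattice S) G T"

lemma arrow_bij: "bij_betw arrow (carrier S) (carrier product_algebra)"
proof (rule bij_betw_imageI)
  show "inj_on arrow (carrier S)"
  proof (rule inj_onI)
    fix s t assume s: "s \<in> carrier S" and eq: "arrow s = arrow t"
    obtain p where "p \<in> arrow s" "p \<in> arrow t"
      using arrow_nonempty[OF s] eq by blast
    then show "s = t"
      unfolding arrow_iff using path_of_inj by blast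
  qed
  have "carrier product_algebra = (\<lambda>xs. path_cong T G `` {path_of xs}) ` words"
    by (auto simp: graph_product_def quotient_def paths_eq_words)
  also have "\<dots> = arrow ` wprod ` words"
    by (simp add: path_class image_image)
  also have "wprod ` words = carrier S"
  proof
    show "wprod ` words \<subseteq> carrier S"
      using words_wprod_closed by blast
    show "carrier S \<subseteq> wprod ` words"
      using word_exists by blast
  qed
  finally show "arrow ` carrier S = carrier product_algebra" by simp
qed

lemma class_of_projection:
  assumes "e \<in> projections S"
  shows "path_cong T G `` {[(e, one T, e)]} = arrow e"
  using path_class[OF words_single[OF projections_in_Y[OF assms]]]
  by (simp add: edge_of_projection[OF assms] wprod_single)

lemma arrow_plus: "s \<in> carrier S \<Longrightarrow> arrow (eplus S s) = eplus product_algebra (arrow s)"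
  by (simp add: graph_product_def arr_dom_arrow class_of_projection plus_in_projections)

lemma arrow_star: "s \<in> carrier S \<Longrightarrow> arrow (estar S s) = estar product_algebra (arrow s)"
  by (simp add: graph_product_def arr_ran_arrow class_of_projection star_in_projections)

text \<open>With \<open>m = s\<^sup>* t\<^sup>+\<close> the factors become \<open>s m\<close> and \<open>m t\<close>, which meet at \<open>m\<close>; and
  \<open>s m m t = s s\<^sup>* t\<^sup>+ t = s t\<close>.\<close>

lemma arrow_mul:
  assumes s: "s \<in> carrier S" and t: "t \<in> carrier S"
  shows "arrow (s \<cdot> t) = arrow s \<cdot>\<^bsub>product_algebra\<^esub> arrow t"
proof -
  define m where "m = estar S s \<cdot> eplus S t"
  have p: "estar S s \<in> projections S" "eplus S t \<in> projections S" "m \<in> projections S"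
    using s t by (simp_all add: m_def star_in_projections plus_in_projections projections_mul)
  note cl = p[THEN projections_closed]
  have ms: "estar S s \<cdot> m = m"
    unfolding m_def using cl p by (simp add: mul_assoc[symmetric] projection_idem)
  have mt: "m \<cdot> eplus S t = m"
    unfolding m_def using cl p by (simp add: mul_assoc projection_idem)
  have ends: "estar S (s \<cdot> m) = eplus S (m \<cdot> t)"
    using star_of_mul_projection[OF p(3) s] plus_of_projection_mul[OF p(3) t] ms mt by simp
  have prod: "(s \<cdot> m) \<cdot> (m \<cdot> t) = s \<cdot> t"
  proof -
    have "(s \<cdot> m) \<cdot> (m \<cdot> t) = s \<cdot> ((m \<cdot> m) \<cdot> t)"
      using s t cl by (simp add: mul_assoc mul_closed)
    also have "\<dots> = (s \<cdot> estar S s) \<cdot> (eplus S t \<cdot> t)"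
      using s t cl projection_idem[OF p(3)] by (simp add: m_def mul_assoc mul_closed)
    finally show ?thesis
      using s t by (simp add: star_right plus_left)
  qed
  have "arrow s \<cdot>\<^bsub>product_algebra\<^esub> arrow t
      = arr_comp T G (arr_cores T G (arrow s) m) (arr_res T G m (arrow t))"
    using s t by (simp add: graph_product_def proj_semilattice_def m_def
        arr_ran_arrow arr_dom_arrow Let_def)
  also have "\<dots> = arr_comp T G (arrow (s \<cdot> m)) (arrow (m \<cdot> t))"
    using s t p ms mt by (simp add: arr_cores_arrow arr_res_arrow)
  also have "\<dots> = arrow (s \<cdot> t)"
    using s t cl ends prod by (simp add: arr_comp_arrow mul_closed)
  finally show ?thesis by simp
qed

lemma arrow_iso: "arrow \<in> ehr_iso S product_algebra"
  by (simp add: ehr_iso_def arrow_bij arrow_mul arrow_plus arrow_star)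

end

theorem theorem3p14:
  fixes S :: "'a ehr" and Y :: "'a set"
  assumes "proper_ehresmann_semigroup S"
    and "proper_generating_ideal S Y"
  shows "ehr_isomorphic S
           (graph_product (proj_semilattice S) (underlying_graph S Y) (sigma_quotient S))"
proof -
  interpret proper_generated S Y
    using assms
    by (simp add: proper_generated_def proper_generated_axioms_def proper_ehresmann_semigroup_def)
  show ?thesis
    using arrow_iso unfolding ehr_isomorphic_def by blast
qed

end
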